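(* For every $\beta>0$, every $\delta>0$ and every $p\in L_\beta^2$, there exists a constant $C=C_{\beta,p,\delta}>0$ not depending on $N$ such that $$\mathbb{P}_{\beta,p}\big(\hat p(\beta,\delta)=p\big)\ \ge\ 1-e^{-CN}$$ for all sufficiently large $N$, where $\hat p(\beta,\delta)$ is the estimator computed from a single sample $\boldsymbol X\sim\mathbb{P}_{\beta,p}$ on $\{-1,1\}^N$ by $$\hat p(\beta,\delta)=\operatorname*{arg\,min}_{\substack{2\le q\le \log_{|\bar X|^{-1}}(2\beta+\delta)+2\\ \beta^*(q)<\beta}}\big|m_*(\beta,q)^2-\bar X^2\big|,\qquad \bar X=\frac1N\sum_{i=1}^N X_i,$$ the minimum being over integers $q$.
   Context: For $\beta>0$, an integer $p\ge 2$ and $N\ge 1$, the $p$-spin Curie-Weiss model is the probability measure on $\{-1,1\}^N$ given by $\mathbb{P}_{\beta,p}(\boldsymbol x)=\exp\{\beta N\bar x^{\,p}\}/Z_N(\beta,p)$, where $\bar x=\frac1N\sum_{i=1}^N x_i$ and $Z_N(\beta,p)$ is the normalizing constant (the dependence of $\mathbb{P}_{\beta,p}$ on $N$ is suppressed). For $x\in[0,1]$ let $H_{\beta,p}(x)=\beta x^p-\frac12\{(1+x)\log(1+x)+(1-x)\log(1-x)\}$, with the convention $0\log 0=0$. Define $\beta^*(p)=\sup\{\beta>0:\sup_{x\in[0,1]}H_{\beta,p}(x)=0\}$, and let $m_*(\beta,q)$ be the largest non-negative global maximizer of $H_{\beta,q}$ on $[0,1]$. For $\beta>0$ let $L_\beta=\{p\ge2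 \text{ integer}:\beta^*(p)<\beta\}$, $L_\beta^1=\{p\in L_\beta:\exists\, q\in L_\beta,\ q\neq p,\ m_*(\beta,q)=m_*(\beta,p)\}$ and $L_\beta^2=L_\beta\setminus L_\beta^1$. Conventions for the estimator: $\log_{b}a=\log a/\log b$; when $\bar X=0$ the upper bound on $q$ is read as $2$; when $|\bar X|=1$ (where the logarithm is undefined) or when the minimizer is not unique, $\hat p(\beta,\delta)$ is given an arbitrary fixed value (respectively, an arbitrary choice among the minimizers). *)

theory Defs
  imports "HOL-Probability.Probability"
begin

definition configs :: "nat \<Rightarrow> (nat \<Rightarrow> real) set" where
  "configs N = {1..N} \<rightarrow>\<^sub>E {-1, 1}"

definition mean :: "nat \<Rightarrow> (nat \<Rightarrow> real) \<Rightarrow> real" where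
  "mean N x = (\<Sum>i=1..N. x i) / real N"

definition gibbs_weight :: "real \<Rightarrow> nat \<Rightarrow> nat \<Rightarrow> (nat \<Rightarrow> real) \<Rightarrow> real" where
  "gibbs_weight \<beta> p N x = exp (\<beta> * real N * mean N x ^ p)"

definition partition_function :: "real \<Rightarrow> nat \<Rightarrow> nat \<Rightarrow> real" where
  "partition_function \<beta> p N = (\<Sum>x\<in>configs N. gibbs_weight \<beta> p N x)"

definition curie_weiss :: "real \<Rightarrow> nat \<Rightarrow> nat \<Rightarrow> (nat \<Rightarrow> real) measure" where
  "curie_weiss \<beta> p N =
     point_measure (configs N) (\<lambda>x. ennreal (gibbs_weight \<beta> p N x / partition_function \<beta> p N))"

text \<open>The library's \<^term>\<open>ln 0 = (0 :: real)\<close> is consistent with the convention that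
  \<open>0 log 0 = 0\<close>, which is needed at \<open>x = 1\<close>.\<close>

definition H :: "real \<Rightarrow> nat \<Rightarrow> real \<Rightarrow> real" where
  "H \<beta> p x = \<beta> * x ^ p - ((1 + x) * ln (1 + x) + (1 - x) * ln (1 - x)) / 2"

definition beta_star :: "nat \<Rightarrow> real" where
  "beta_star p = Sup {\<beta>. \<beta> > 0 \<and> (SUP x\<in>{0..1}. H \<beta> p x) = 0}"

definition m_star :: "real \<Rightarrow> nat \<Rightarrow> real" where
  "m_star \<beta> q = (GREATEST x. is_arg_max (H \<beta> q) (\<lambda>y. y \<in> {0..1}) x)"

definition L :: "real \<Rightarrow> nat set" where
  "L \<beta> = {p. 2 \<le> p \<and> beta_star p < \<beta>}"

definition L1 :: "real \<Rightarrow> nat set" where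
  "L1 \<beta> = {p \<in> L \<beta>. \<exists>q\<in>L \<beta>. q \<noteq> p \<and> m_star \<beta> q = m_star \<beta> p}"

definition L2 :: "real \<Rightarrow> nat set" where
  "L2 \<beta> = L \<beta> - L1 \<beta>"

definition candidates :: "real \<Rightarrow> real \<Rightarrow> real \<Rightarrow> nat set" where
  "candidates \<beta> \<delta> m =
     {q. 2 \<le> q \<and> real q \<le> (if m = 0 then 2 else log (inverse \<bar>m\<bar>) (2 * \<beta> + \<delta>) + 2)
         \<and> beta_star q < \<beta>}"

text \<open>A version of the estimator is any statistic \<open>phat\<close> that picks a minimizer over the candidates.
  It is unconstrained on samples whose mean is \<open>1\<close> or \<open>-1\<close> and on samples without candidates,
  and ties between minimizers may be broken arbitrarily.\<close>

definition is_estimator :: "real \<Rightarrow> real \<Rightarrow> (nat \<Rightarrow> (nat \<Rightarrow> real) \<Rightarrow> nat) \<Rightarrow> bool" where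
  "is_estimator \<beta> \<delta> phat \<longleftrightarrow>
     (\<forall>N\<ge>1. \<forall>x\<in>configs N.
        \<bar>mean N x\<bar> \<noteq> 1 \<longrightarrow> candidates \<beta> \<delta> (mean N x) \<noteq> {} \<longrightarrow>
        is_arg_min (\<lambda>q. \<bar>(m_star \<beta> q)\<^sup>2 - (mean N x)\<^sup>2\<bar>)
          (\<lambda>q. q \<in> candidates \<beta> \<delta> (mean N x)) (phat N x))"

lemma finite_configs: "finite (configs N)"
  unfolding configs_def by (intro finite_PiE) auto

lemma configs_nonempty: "configs N \<noteq> {}"
  unfolding configs_def by (simp add: PiE_eq_empty_iff)

lemma partition_function_pos: "partition_function \<beta> p N > 0"
  unfolding partition_function_def gibbs_weight_def
  by (intro sum_pos finite_configs configs_nonempty) simp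

lemma space_curie_weiss: "space (curie_weiss \<beta> p N) = configs N"
  by (simp add: curie_weiss_def space_point_measure)

lemma sets_curie_weiss: "sets (curie_weiss \<beta> p N) = Pow (configs N)"
  by (simp add: curie_weiss_def sets_point_measure)

lemma prob_space_curie_weiss: "prob_space (curie_weiss \<beta> p N)"
proof
  have "emeasure (curie_weiss \<beta> p N) (configs N)
      = (\<Sum>x\<in>configs N. ennreal (gibbs_weight \<beta> p N x / partition_function \<beta> p N))"
    unfolding curie_weiss_def by (simp add: emeasure_point_measure_finite finite_configs)
  also have "\<dots> = ennreal (\<Sum>x\<in>configs N. gibbs_weight \<beta> p N x / partition_function \<beta> p N)"
    using partition_function_pos[of \<beta> p N] by (intro sum_ennreal) (auto simp: gibbs_weight_def)
  also have "(\<Sum>x\<in>configs N. gibbs_weight \<beta> p N x / partition_function \<beta> p N) = 1"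
    using partition_function_pos[of \<beta> p N]
    by (simp add: sum_divide_distrib[symmetric] partition_function_def)
  finally show "emeasure (curie_weiss \<beta> p N) (space (curie_weiss \<beta> p N)) = 1"
    by (simp add: space_curie_weiss)
qed

lemma finite_candidates: "finite (candidates \<beta> \<delta> m)"
proof -
  define u where "u = (if m = 0 then 2 else log (inverse \<bar>m\<bar>) (2 * \<beta> + \<delta>) + 2)"
  have "candidates \<beta> \<delta> m \<subseteq> {q. real q \<le> u}"
    unfolding candidates_def u_def by auto
  also have "{q. real q \<le> u} \<subseteq> {..nat \<lfloor>u\<rfloor>}"
    by (auto simp: le_nat_floor)
  finally show ?thesis
    by (rule finite_subset) simp
qed

lemma ex_is_estimator: "\<exists>phat. is_estimator \<beta> \<delta> phat"
proof -
  let ?f = "\<lambda>N x q. \<bar>(m_star \<beta> q)\<^sup>2 - (mean N x)\<^sup>2\<bar>"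
  let ?A = "\<lambda>N x. candidates \<beta> \<delta> (mean N x)"
  have "is_arg_min (?f N x) (\<lambda>q. q \<in> ?A N x) (arg_min_on (?f N x) (?A N x))"
    if "?A N x \<noteq> {}" for N x
    unfolding arg_min_on_def arg_min_def
    by (rule someI_ex, rule ex_is_arg_min_if_finite[OF finite_candidates that])
  then have "is_estimator \<beta> \<delta> (\<lambda>N x. arg_min_on (?f N x) (?A N x))"
    unfolding is_estimator_def by blast
  then show ?thesis
    by blast
qed

end

theory Submission
  imports Defs "HOL-Real_Asymp.Real_Asymp"
begin

text \<open>For \<open>\<beta> > beta_star p\<close> the maximum of \<open>H \<beta> p\<close> over \<open>{0..1}\<close> is positive and attained at the single
  point \<open>m = m_star \<beta> p\<close>, so \<open>\<bar>mean N x\<bar>\<close> is within any given distance of \<open>m\<close> outside an event of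
  exponentially small probability: a level set of the mean has at most \<open>2 ^ N * exp (- N * rate y)\<close>
  points, while the Gibbs variational principle bounds the partition function from below by
  \<open>exp (N * (ln 2 + H \<beta> p m - o(1)))\<close>.

  For \<open>y = \<bar>mean N x\<bar>\<close> close to \<open>m\<close> the estimator returns \<open>p\<close>. Indeed \<open>rate m \<ge> m\<^sup>2 / 2\<close> and
  \<open>H \<beta> p m > 0\<close> give \<open>2 * \<beta> * m ^ (p - 2) \<ge> 1\<close>, so the slack \<open>\<delta>\<close> keeps \<open>p\<close> among the candidates.
  Since \<open>m < 1\<close>, the candidates are bounded uniformly in such \<open>y\<close>, and each of the finitely many
  competitors \<open>q\<close> has \<open>m_star \<beta> q \<noteq> m\<close> because \<open>p \<in> L2 \<beta>\<close>.\<close>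

section \<open>The rate function\<close>

text \<open>Cramer's rate function of a fair spin: for \<open>\<bar>x\<bar> \<le> 1\<close> it is
  \<open>ln 2\<close> minus the entropy of a coin with bias \<open>(1 + x) / 2\<close>.\<close>

definition rate :: "real \<Rightarrow> real" where
  "rate x = ((1 + x) * ln (1 + x) + (1 - x) * ln (1 - x)) / 2"

lemma H_eq_rate: "H \<beta> p x = \<beta> * x ^ p - rate x"
  by (simp add: H_def rate_def)

lemma rate_abs: "rate \<bar>x\<bar> = rate x"
  by (simp add: rate_def abs_if)

text \<open>The convention \<open>ln 0 = 0\<close> makes the product agree with its limit at 0, so
  \<open>H\<close> is continuous up to the endpoint 1 and compactness applies on
  \<open>{0..1}\<close>.\<close>

lemma continuous_on_mult_ln: "continuous_on {0..} (\<lambda>x::real. x * ln x)"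
  unfolding continuous_on_eq_continuous_within
proof
  fix x :: real
  assume "x \<in> {0..}"
  then consider "x = 0" | "x > 0" by fastforce
  then show "continuous (at x within {0..}) (\<lambda>x. x * ln x)"
  proof cases
    case 1
    have "((\<lambda>x::real. x * ln x) \<longlongrightarrow> 0) (at_right 0)"
      by real_asymp
    with 1 show ?thesis
      by (simp add: continuous_within at_within_Ici_at_right)
  next
    case 2
    then show ?thesis
      by (intro continuous_intros) auto
  qed
qed

lemma continuous_on_H: "continuous_on {0..1} (H \<beta> p)"
proof -
  have plus: "continuous_on {0..1::real} (\<lambda>x. (1 + x) * ln (1 + x))"
    by (intro continuous_on_compose2[OF continuous_on_mult_ln]) (auto intro!: continuous_intros)
  have minus: "continuous_on {0..1::real} (\<lambda>x. (1 - x) * ln (1 - x))"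
    by (intro continuous_on_compose2[OF continuous_on_mult_ln]) (auto intro!: continuous_intros)
  show ?thesis
    unfolding H_def
    by (rule continuous_on_diff[OF _ continuous_on_divide[OF continuous_on_add[OF plus minus]
          continuous_on_const]]) (auto intro!: continuous_intros)
qed

text \<open>Adds the series of \<open>(1/2) * ln (1 - x\<^sup>2)\<close> and
  \<open>(x/2) * ln ((1 + x) / (1 - x))\<close>, whose sum is \<open>rate x\<close>. What matters
  later is that all coefficients are positive.\<close>

lemma rate_sums:
  assumes "0 \<le> x" "x < 1"
  shows "(\<lambda>n. x ^ (2 * Suc n) / ((2 * real n + 1) * (2 * real n + 2))) sums rate x"
proof -
  have "x\<^sup>2 < 1"
    using assms by (simp add: power_less_one_iff)
  then have "(\<lambda>n. - ((- (- x\<^sup>2)) ^ n) / real n) sums ln (1 + - x\<^sup>2)"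
    using assms by (intro ln_series') simp
  then have "(\<lambda>n. - ((x\<^sup>2) ^ n) / real n) sums ln (1 - x\<^sup>2)"
    by simp
  \<comment> \<open>The term for n = 0 is 0 because division by zero gives 0, so the shifted series
    has the same sum.\<close>
  then have "(\<lambda>n. - ((x\<^sup>2) ^ Suc n) / real (Suc n)) sums ln (1 - x\<^sup>2)"
    by (subst sums_Suc_iff) simp
  then have s1: "(\<lambda>n. (1/2) * (- ((x\<^sup>2) ^ Suc n) / real (Suc n))) sums ((1/2) * ln (1 - x\<^sup>2))"
    by (rule sums_mult)
  have q: "((1 + x) / (1 - x) - 1) / ((1 + x) / (1 - x) + 1) = x"
    using assms by (simp add: field_simps)
  have "(1 + x) / (1 - x) > 0"
    using assms by simp
  from ln_series_quadratic[OF this]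
  have "(\<lambda>n. 2 * x ^ (2 * n + 1) / real (2 * n + 1)) sums ln ((1 + x) / (1 - x))"
    unfolding q by simp
  then have s2: "(\<lambda>n. (x/2) * (2 * x ^ (2 * n + 1) / real (2 * n + 1)))
      sums ((x/2) * ln ((1 + x) / (1 - x)))"
    by (rule sums_mult)
  have "1 - x\<^sup>2 = (1 + x) * (1 - x)"
    by (simp add: power2_eq_square algebra_simps)
  then have l1: "ln (1 - x\<^sup>2) = ln (1 + x) + ln (1 - x)"
    using assms by (simp add: ln_mult)
  have l2: "ln ((1 + x) / (1 - x)) = ln (1 + x) - ln (1 - x)"
    using assms by (simp add: ln_div)
  have v: "(1/2) * ln (1 - x\<^sup>2) + (x/2) * ln ((1 + x) / (1 - x)) = rate x"
    unfolding l1 l2 by (simp add: rate_def field_simps)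
  \<comment> \<open>The coefficients combine as 1/(2n+1) - 1/(2n+2).\<close>
  have t: "(1/2) * (- ((x\<^sup>2) ^ Suc n) / real (Suc n)) + (x/2) * (2 * x ^ (2 * n + 1) / real (2 * n + 1))
      = x ^ (2 * Suc n) / ((2 * real n + 1) * (2 * real n + 2))" for n
  proof -
    define z where "z = x ^ (2 * Suc n)"
    have "(x\<^sup>2) ^ Suc n = z"
      unfolding z_def by (simp only: power_mult)
    moreover have "(x/2) * (2 * x ^ (2 * n + 1) / real (2 * n + 1)) = z / real (2 * n + 1)"
      by (simp add: z_def)
    ultimately show ?thesis
      by (simp add: z_def[symmetric] divide_simps) (simp add: algebra_simps)
  qed
  show ?thesis
    using sums_add[OF s1 s2] unfolding v t .
qed

text \<open>The bound is the first term of the nonnegative series in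
  \<open>rate_sums\<close>.\<close>

lemma rate_ge_half_square:
  assumes "0 \<le> x" "x < 1"
  shows "rate x \<ge> x\<^sup>2 / 2"
proof -
  let ?f = "\<lambda>n. x ^ (2 * Suc n) / ((2 * real n + 1) * (2 * real n + 2))"
  have "(\<Sum>n<1. ?f n) \<le> suminf ?f"
    using assms rate_sums[OF assms] by (intro sum_le_suminf) (auto simp: sums_iff)
  then show ?thesis
    using rate_sums[OF assms] by (simp add: sums_iff power2_eq_square)
qed

text \<open>Along \<open>x = exp t\<close> the function \<open>(M + rate x) / x ^ p\<close> is a sum of exponentials in \<open>t\<close>, hence
  strictly convex. So \<open>H\<close> cannot attain a positive maximum \<open>M\<close> at two points.\<close>

lemma H_geometric_mean_greater:
  assumes "0 < a" "a < b" "b < 1" "p > 0" "M > 0" "H \<beta> p a = M" "H \<beta> p b = M"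
  shows "H \<beta> p (sqrt a * sqrt b) > M"
proof -
  define A B where "A = sqrt a" and "B = sqrt b"
  have AB: "0 < A" "A < B" "B < 1" and sq: "a = A\<^sup>2" "b = B\<^sup>2"
    using assms by (auto simp: A_def B_def)
  define c where "c = A * B"
  \<comment> \<open>This weight makes \<open>r * a ^ p\<close> and \<open>b ^ p / r\<close> both
    equal to \<open>c ^ p\<close>, so the power term of \<open>H\<close> is reproduced exactly at
    the geometric mean \<open>c\<close>.\<close>
  define r where "r = (B / A) ^ p"
  have "r > 1"
    unfolding r_def using AB assms by (intro one_less_power) auto
  have "c < 1"
    unfolding c_def using AB mult_strict_mono[of A 1 B 1] by simp
  have "c \<ge> 0"
    using AB by (simp add: c_def)
  have ca: "r * a ^ p = c ^ p"
    using AB by (simp add: r_def sq c_def power_divide power_mult_distrib power2_eq_square)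
  have cb: "b ^ p / r = c ^ p"
    using AB by (simp add: r_def sq c_def power_divide power_mult_distrib power2_eq_square)
  \<comment> \<open>AM-GM: the product of \<open>r * a ^ j\<close> and \<open>b ^ j / r\<close> is
    the square of \<open>c ^ j\<close>.\<close>
  have amgm: "c ^ j \<le> (r * a ^ j + b ^ j / r) / 2" for j
  proof -
    have "0 \<le> (r * A ^ j - B ^ j)\<^sup>2"
      by simp
    also have "\<dots> = r * (r * a ^ j + b ^ j / r - 2 * c ^ j)"
      using \<open>r > 1\<close> by (simp add: sq c_def power2_eq_square power_mult_distrib algebra_simps)
    finally show ?thesis
      using \<open>r > 1\<close> by (simp add: zero_le_mult_iff)
  qed
  let ?w = "\<lambda>n. (2 * real n + 1) * (2 * real n + 2)"
  have sa: "(\<lambda>n. a ^ (2 * Suc n) / ?w n) sums rate a"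
    by (rule rate_sums) (use assms in auto)
  have sb: "(\<lambda>n. b ^ (2 * Suc n) / ?w n) sums rate b"
    by (rule rate_sums) (use assms in auto)
  have sc: "(\<lambda>n. c ^ (2 * Suc n) / ?w n) sums rate c"
    by (rule rate_sums) fact+
  have sm: "(\<lambda>n. (r * (a ^ (2 * Suc n) / ?w n) + (b ^ (2 * Suc n) / ?w n) / r) / 2)
      sums ((r * rate a + rate b / r) / 2)"
    by (intro sums_divide sums_add sums_mult sa sb)
  have "rate c \<le> (r * rate a + rate b / r) / 2"
  proof (rule sums_le[OF _ sc sm])
    fix n
    have "c ^ (2 * Suc n) / ?w n \<le> ((r * a ^ (2 * Suc n) + b ^ (2 * Suc n) / r) / 2) / ?w n"
      by (intro divide_right_mono amgm) auto
    also have "\<dots> = (r * (a ^ (2 * Suc n) / ?w n) + (b ^ (2 * Suc n) / ?w n) / r) / 2"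
      by (simp only: add_divide_distrib times_divide_eq_right divide_divide_eq_left mult.commute mult.left_commute)
    finally show "c ^ (2 * Suc n) / ?w n
        \<le> (r * (a ^ (2 * Suc n) / ?w n) + (b ^ (2 * Suc n) / ?w n) / r) / 2" .
  qed
  also have "\<dots> = (r * (\<beta> * a ^ p - M) + (\<beta> * b ^ p - M) / r) / 2"
    using assms by (auto simp: H_eq_rate)
  also have "\<dots> = (\<beta> * (r * a ^ p) + \<beta> * (b ^ p / r) - M * (r + 1 / r)) / 2"
    by (simp add: algebra_simps diff_divide_distrib)
  also have "\<dots> = \<beta> * c ^ p - M * ((r + 1 / r) / 2)"
    unfolding ca cb by (simp add: field_simps)
  \<comment> \<open>Strictness comes from \<open>r + 1 / r > 2\<close>, multiplied by the positive
    \<open>M\<close>.\<close>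
  also have "\<dots> < \<beta> * c ^ p - M * 1"
  proof -
    have "0 < (r - 1)\<^sup>2 / r"
      using \<open>r > 1\<close> by simp
    also have "\<dots> = r + 1 / r - 2"
      using \<open>r > 1\<close> by (simp add: field_simps power2_eq_square)
    finally have "(r + 1 / r) / 2 > 1"
      by simp
    then show ?thesis
      using \<open>M > 0\<close> by (intro diff_strict_left_mono mult_strict_left_mono)
  qed
  finally show ?thesis
    by (simp add: H_eq_rate c_def A_def B_def)
qed

section \<open>Location and uniqueness of the maximizer above the threshold\<close>

lemma H_one_not_max:
  assumes "\<beta> > 0"
  shows "\<exists>x\<in>{0..1}. H \<beta> p x > H \<beta> p 1"
proof -
  \<comment> \<open>The slope of \<open>rate\<close> is infinite at 1, that of the power is not.
    With this \<open>t\<close> the gain \<open>- t * ln t / 2\<close> cancels the Bernoulli loss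
    \<open>\<beta> * real p * t\<close> exactly, and a surplus of \<open>t * ln 2 / 2\<close>
    remains.\<close>
  define t where "t = exp (- (2 * \<beta> * real p))"
  have t: "0 < t" "t \<le> 1"
    using assms by (auto simp: t_def)
  have "1 + real p * (- t) \<le> (1 + (- t)) ^ p"
    using t by (intro Bernoulli_inequality) simp
  then have "\<beta> * (1 - real p * t) \<le> \<beta> * (1 - t) ^ p"
    using assms by (intro mult_left_mono) auto
  then have b: "\<beta> - \<beta> * real p * t \<le> \<beta> * (1 - t) ^ p"
    by (simp add: algebra_simps)
  have "(2 - t) * ln (2 - t) \<le> (2 - t) * ln 2"
    using t by (intro mult_left_mono) auto
  then have l: "(2 - t) * ln (2 - t) \<le> 2 * ln 2 - t * ln 2"
    by (simp add: left_diff_distrib)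
  have tl: "t * ln t = - 2 * (\<beta> * real p * t)"
    by (simp add: t_def)
  have l2: "0 < t * ln 2"
    using t by simp
  have arith: "b - l < P - (X + Y) / 2"
    if "b - z \<le> P" "X \<le> 2 * l - s" "Y = - 2 * z" "0 < s" for b l P X Y z s :: real
    using that by (simp add: field_simps)
  have "H \<beta> p 1 < H \<beta> p (1 - t)"
    using arith[OF b l tl l2] by (simp add: H_def)
  then show ?thesis
    using t by (intro bexI[of _ "1 - t"]) auto
qed

lemma H_pos_above_beta_star:
  assumes "\<beta> > 0" "p > 0" "beta_star p < \<beta>"
  shows "\<exists>x\<in>{0..1}. H \<beta> p x > 0"
proof -
  have bdd: "bdd_above (H \<gamma> p ` {0..1})" for \<gamma>
    by (intro bounded_imp_bdd_above compact_imp_bounded compact_continuous_image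
        continuous_on_H compact_Icc)
  define A where "A = {\<beta>. \<beta> > 0 \<and> (SUP x\<in>{0..1}. H \<beta> p x) = 0}"
  \<comment> \<open>The value at 1 is \<open>\<gamma> - ln 2\<close>; this bounds the set defining
    \<open>beta_star p\<close>, so that its \<open>Sup\<close> really is an upper bound.\<close>
  have "\<gamma> \<le> ln 2" if "\<gamma> \<in> A" for \<gamma>
  proof -
    have "H \<gamma> p 1 \<le> (SUP x\<in>{0..1}. H \<gamma> p x)"
      by (rule cSUP_upper[OF _ bdd]) simp
    with that show ?thesis
      by (simp add: A_def H_def)
  qed
  then have "bdd_above A"
    by (auto simp: bdd_above_def)
  then have "\<beta> \<notin> A"
    using assms cSup_upper[of \<beta> A] by (auto simp: beta_star_def A_def[symmetric])
  with assms have ne: "(SUP x\<in>{0..1}. H \<beta> p x) \<noteq> 0"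
    by (simp add: A_def)
  have "H \<beta> p 0 \<le> (SUP x\<in>{0..1}. H \<beta> p x)"
    by (rule cSUP_upper[OF _ bdd]) simp
  moreover have "H \<beta> p 0 = 0"
    using assms by (simp add: H_def)
  ultimately have "0 < (SUP x\<in>{0..1}. H \<beta> p x)"
    using ne by simp
  then show ?thesis
    by (subst (asm) less_cSUP_iff[OF _ bdd]) auto
qed

text \<open>Resolves the \<open>GREATEST\<close> in \<open>m_star\<close>. Compactness gives a
  maximizer, the value 0 at 0 and \<open>H_one_not_max\<close> keep it off the endpoints, and
  \<open>H_geometric_mean_greater\<close> excludes a second one.\<close>

lemma m_star_unique_max:
  assumes "\<beta> > 0" "p > 0" "beta_star p < \<beta>"
  shows "0 < m_star \<beta> p" "m_star \<beta> p < 1" "H \<beta> p (m_star \<beta> p) > 0"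
    and "\<And>y. y \<in> {0..1} \<Longrightarrow> y \<noteq> m_star \<beta> p \<Longrightarrow> H \<beta> p y < H \<beta> p (m_star \<beta> p)"
proof -
  obtain m where m: "m \<in> {0..1}" "\<And>y. y \<in> {0..1} \<Longrightarrow> H \<beta> p y \<le> H \<beta> p m"
    using continuous_attains_sup[OF compact_Icc _ continuous_on_H] by force
  have pos: "H \<beta> p m > 0"
    using H_pos_above_beta_star[OF assms] m(2) by force
  have range: "0 < y" "y < 1" if "y \<in> {0..1}" "H \<beta> p y = H \<beta> p m" for y
  proof -
    have "H \<beta> p 0 = 0"
      using assms by (simp add: H_def)
    with that pos have "y \<noteq> 0"
      by auto
    moreover have "y \<noteq> 1"
      using H_one_not_max[OF assms(1), of p] m(2) that(2) by force
    ultimately show "0 < y" "y < 1"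
      using that by auto
  qed
  have no_two: False
    if "0 < a" "a < b" "b < 1" "H \<beta> p a = H \<beta> p m" "H \<beta> p b = H \<beta> p m" for a b
  proof -
    have "sqrt a * sqrt b \<le> 1 * 1"
      using that by (intro mult_mono) auto
    then have "sqrt a * sqrt b \<in> {0..1}"
      using that by auto
    with m(2) H_geometric_mean_greater[OF that(1-3) assms(2) pos that(4,5)] show False
      by force
  qed
  have strict: "H \<beta> p y < H \<beta> p m" if "y \<in> {0..1}" "y \<noteq> m" for y
  proof (rule ccontr)
    assume "\<not> ?thesis"
    with m(2)[OF that(1)] have "H \<beta> p y = H \<beta> p m"
      by simp
    with that m(1) show False
      using no_two[of y m] no_two[of m y] range[of y] range[of m] by (cases "y < m") auto
  qed
  have "m_star \<beta> p = m"
    unfolding m_star_def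
  proof (rule Greatest_equality)
    show "is_arg_max (H \<beta> p) (\<lambda>y. y \<in> {0..1}) m"
      using m by (auto simp: is_arg_max_def not_less)
    show "y \<le> m" if "is_arg_max (H \<beta> p) (\<lambda>y. y \<in> {0..1}) y" for y
      using that strict[of y] m(1) by (cases "y = m") (auto simp: is_arg_max_def)
  qed
  with range[OF m(1)] pos strict
  show "0 < m_star \<beta> p" "m_star \<beta> p < 1" "H \<beta> p (m_star \<beta> p) > 0"
    "\<And>y. y \<in> {0..1} \<Longrightarrow> y \<noteq> m_star \<beta> p \<Longrightarrow> H \<beta> p y < H \<beta> p (m_star \<beta> p)"
    by auto
qed

text \<open>The origin of \<open>2 * \<beta>\<close> in the cutoff of \<open>candidates\<close>:
  positivity of \<open>H\<close> at the maximizer gives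
  \<open>\<beta> * m ^ p > rate m \<ge> m\<^sup>2 / 2\<close>, and \<open>m\<^sup>2\<close>
  cancels.\<close>

lemma m_star_power_ge:
  assumes "\<beta> > 0" "p \<ge> 2" "beta_star p < \<beta>"
  shows "2 * \<beta> * m_star \<beta> p ^ (p - 2) \<ge> 1"
proof -
  define m where "m = m_star \<beta> p"
  have m: "0 < m" "m < 1" "H \<beta> p m > 0"
    using m_star_unique_max[of \<beta> p] assms by (auto simp: m_def)
  have "m\<^sup>2 / 2 \<le> \<beta> * m ^ p"
    using rate_ge_half_square[of m] m by (simp add: H_eq_rate)
  also have "m ^ p = m\<^sup>2 * m ^ (p - 2)"
    using assms(2) by (metis le_add_diff_inverse power_add)
  finally have "m\<^sup>2 * 1 \<le> m\<^sup>2 * (2 * \<beta> * m ^ (p - 2))"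
    by (simp add: algebra_simps)
  then show ?thesis
    using m by (simp add: m_def)
qed

text \<open>Compactness turns the strict inequality into a uniform gap, which later sets the
  exponential rate.\<close>

lemma H_gap:
  assumes "open U" "m \<in> U" and "\<And>y. y \<in> {0..1} \<Longrightarrow> y \<noteq> m \<Longrightarrow> H \<beta> p y < H \<beta> p m"
  shows "\<exists>\<eta>>0. \<forall>y\<in>{0..1} - U. H \<beta> p y \<le> H \<beta> p m - \<eta>"
proof (cases "{0..1} - U = {}")
  case True
  show ?thesis
    unfolding True by (auto intro: exI[of _ 1])
next
  case False
  have "compact ({0..1} - U)"
    using assms by (intro compact_diff) auto
  then obtain z where z: "z \<in> {0..1} - U" "\<And>y. y \<in> {0..1} - U \<Longrightarrow> H \<beta> p y \<le> H \<beta> p z"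
    using continuous_attains_sup[OF _ False continuous_on_subset[OF continuous_on_H]] by (metis Diff_subset)
  have "H \<beta> p z < H \<beta> p m"
    using assms z by auto
  with z show ?thesis
    by (intro exI[of _ "H \<beta> p m - H \<beta> p z"]) auto
qed

section \<open>Concentration of the sample mean\<close>

text \<open>Encodes a configuration by its set of positive spins and groups these sets by
  cardinality, leaving N + 1 terms.\<close>

lemma sum_configs:
  "(\<Sum>x\<in>configs N. g (mean N x)) = (\<Sum>k\<le>N. real (N choose k) * g ((2 * real k - real N) / real N))"
proof -
  let ?F = "\<lambda>A. \<lambda>i\<in>{1..N}. if i \<in> A then 1 else - 1 :: real"
  have bij: "bij_betw ?F (Pow {1..N}) (configs N)"
  proof (rule bij_betw_byWitness[where f' = "\<lambda>x. {i\<in>{1..N}. x i = 1}"])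
    show "\<forall>A\<in>Pow {1..N}. {i \<in> {1..N}. ?F A i = 1} = A"
      by auto
    show "\<forall>x\<in>configs N. ?F {i \<in> {1..N}. x i = 1} = x"
    proof
      fix x
      assume "x \<in> configs N"
      then show "?F {i \<in> {1..N}. x i = 1} = x"
        unfolding configs_def by (intro ext) (auto simp: PiE_def extensional_def Pi_def restrict_def)
    qed
  qed (auto simp: configs_def split: if_splits)
  have mean: "mean N (?F A) = (2 * real (card A) - real N) / real N" if "A \<subseteq> {1..N}" for A
  proof -
    have "(\<Sum>i=1..N. ?F A i) = (\<Sum>i=1..N. 2 * (if i \<in> A then 1 else 0) - 1)"
      by (intro sum.cong) auto
    also have "\<dots> = 2 * (\<Sum>i=1..N. if i \<in> A then 1 else 0) - real N"
      by (simp add: sum_subtractf sum_distrib_left)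
    also have "(\<Sum>i=1..N. if i \<in> A then 1 else 0) = real (card A)"
      using that by (subst sum.inter_restrict[symmetric]) (auto simp: Int_absorb1)
    finally show ?thesis
      by (simp add: mean_def)
  qed
  let ?g = "\<lambda>k. g ((2 * real k - real N) / real N)"
  have "(\<Sum>x\<in>configs N. g (mean N x)) = (\<Sum>A\<in>Pow {1..N}. g (mean N (?F A)))"
    by (rule sum.reindex_bij_betw[OF bij, symmetric])
  also have "\<dots> = (\<Sum>A\<in>Pow {1..N}. ?g (card A))"
    by (intro sum.cong arg_cong[where f = g] mean) auto
  also have "\<dots> = (\<Sum>k\<le>N. \<Sum>A | A \<in> Pow {1..N} \<and> card A = k. ?g (card A))"
  proof (rule sum.group[symmetric])
    show "card ` Pow {1..N} \<subseteq> {..N}"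
      using card_mono[of "{1..N}"] by fastforce
  qed auto
  also have "\<dots> = (\<Sum>k\<le>N. real (N choose k) * ?g k)"
  proof (rule sum.cong[OF refl])
    fix k
    have "card {A \<in> Pow {1..N}. card A = k} = N choose k"
      using n_subsets[of "{1..N}" k] by simp
    then show "(\<Sum>A | A \<in> Pow {1..N} \<and> card A = k. ?g (card A)) = real (N choose k) * ?g k"
      by simp
  qed
  finally show ?thesis .
qed

text \<open>At \<open>t = 0\<close> the product rule for \<open>ln\<close> fails, but the factor
  \<open>t\<close> removes the error, so \<open>rate_entropy\<close> reaches the endpoints.\<close>

lemma mult_ln_half: "t * ln t = t * (ln (2 * t) - ln 2)" if "t \<ge> 0" for t :: real
  using that by (cases "t = 0") (auto simp: ln_mult)

lemma rate_entropy:
  assumes "\<bar>x\<bar> \<le> 1"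
  shows "(1 + x) / 2 * ln ((1 + x) / 2) + (1 - x) / 2 * ln ((1 - x) / 2) = rate x - ln 2"
proof -
  have double: "2 * ((1 + x) / 2) = 1 + x" "2 * ((1 - x) / 2) = 1 - x"
    by simp_all
  have l: "(1 + x) / 2 * ln ((1 + x) / 2) = (1 + x) / 2 * (ln (1 + x) - ln 2)"
    "(1 - x) / 2 * ln ((1 - x) / 2) = (1 - x) / 2 * (ln (1 - x) - ln 2)"
    using assms mult_ln_half[of "(1 + x) / 2", unfolded double]
      mult_ln_half[of "(1 - x) / 2", unfolded double] by auto
  show ?thesis
    unfolding l by (simp add: rate_def field_simps)
qed

text \<open>The binomial distribution with parameter \<open>k / N\<close> gives mass at most \<open>1\<close> to \<open>k\<close>.\<close>

lemma binomial_le_exp_rate: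
  assumes "N \<ge> 1" "k \<le> N"
  shows "real (N choose k) \<le> exp (real N * (ln 2 - rate ((2 * real k - real N) / real N)))"
proof -
  define t where "t = real k / real N"
  define x where "x = (2 * real k - real N) / real N"
  have t: "0 \<le> t" "t \<le> 1" "real k = real N * t" "real (N - k) = real N * (1 - t)"
    using assms by (auto simp: t_def field_simps of_nat_diff)
  have x: "x = 2 * t - 1" "(1 + x) / 2 = t" "(1 - x) / 2 = 1 - t"
    using assms by (auto simp: t_def x_def field_simps)
  \<comment> \<open>At \<open>k = 0\<close>, and below at \<open>k = N\<close>, base and exponent
    are both 0, and both sides are 1.\<close>
  have p1: "t ^ k = exp (real k * ln t)"
    using assms by (cases "k = 0") (auto simp: t_def exp_of_nat_mult)
  have p2: "(1 - t) ^ (N - k) = exp (real (N - k) * ln (1 - t))"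
  proof (cases "k = N")
    case False
    then have "1 - t > 0"
      using assms by (simp add: t_def)
    then show ?thesis
      by (simp add: exp_of_nat_mult)
  qed simp
  have "t * ln t + (1 - t) * ln (1 - t) = rate x - ln 2"
    using rate_entropy[of x] t unfolding x(2,3) by (simp add: x(1))
  moreover have "real k * ln t + real (N - k) * ln (1 - t) = real N * (t * ln t + (1 - t) * ln (1 - t))"
    unfolding t(3,4) by (simp add: algebra_simps)
  ultimately have "real k * ln t + real (N - k) * ln (1 - t) = real N * (rate x - ln 2)"
    by simp
  then have "Bernstein N k t = real (N choose k) * exp (real N * (rate x - ln 2))"
    by (simp add: Bernstein_def p1 p2 flip: exp_add)
  moreover have "Bernstein N k t \<le> (\<Sum>j\<le>N. Bernstein N j t)"
    using assms t by (intro member_le_sum Bernstein_nonneg) auto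
  ultimately have "real (N choose k) * exp (real N * (rate x - ln 2)) \<le> 1"
    by simp
  then have "real (N choose k) \<le> 1 / exp (real N * (rate x - ln 2))"
    by (subst pos_le_divide_eq) auto
  also have "\<dots> = exp (- (real N * (rate x - ln 2)))"
    by (simp only: exp_minus inverse_eq_divide)
  also have "- (real N * (rate x - ln 2)) = real N * (ln 2 - rate x)"
    by (simp add: algebra_simps)
  finally show ?thesis
    by (simp add: x_def)
qed

text \<open>By the entropy bound, each of the N + 1 possible means y contributes at most
  \<open>exp (real N * (ln 2 + H \<beta> p \<bar>y\<bar>))\<close>.\<close>

lemma gibbs_weight_sum_le:
  assumes "\<beta> > 0" "N \<ge> 1" and M: "\<And>y. y \<in> {0..1} - U \<Longrightarrow> H \<beta> p y \<le> M"
  shows "(\<Sum>x | x \<in> configs N \<and> \<bar>mean N x\<bar> \<notin> U. gibbs_weight \<beta> p N x)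
      \<le> (real N + 1) * exp (real N * (ln 2 + M))"
proof -
  let ?x = "\<lambda>k. (2 * real k - real N) / real N"
  let ?g = "\<lambda>y. if \<bar>y\<bar> \<notin> U then exp (\<beta> * real N * y ^ p) else 0"
  have "(\<Sum>x | x \<in> configs N \<and> \<bar>mean N x\<bar> \<notin> U. gibbs_weight \<beta> p N x) = (\<Sum>x\<in>configs N. ?g (mean N x))"
    by (subst sum.inter_filter[OF finite_configs]) (auto simp: gibbs_weight_def intro!: sum.cong)
  also have "\<dots> = (\<Sum>k\<le>N. real (N choose k) * ?g (?x k))"
    by (rule sum_configs)
  also have "\<dots> \<le> (\<Sum>k\<le>N. exp (real N * (ln 2 + M)))"
  proof (rule sum_mono)
    fix k
    assume k: "k \<in> {..N}"
    define y where "y = ?x k"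
    have y: "\<bar>y\<bar> \<le> 1"
      using assms k by (auto simp: y_def abs_le_iff field_simps)
    show "real (N choose k) * ?g (?x k) \<le> exp (real N * (ln 2 + M))"
    proof (cases "\<bar>y\<bar> \<in> U")
      case False
      have "real (N choose k) * ?g (?x k)
          \<le> exp (real N * (ln 2 - rate y)) * exp (\<beta> * real N * y ^ p)"
        using binomial_le_exp_rate[OF assms(2), of k] k False by (simp add: y_def)
      also have "\<dots> = exp (real N * (ln 2 + (\<beta> * y ^ p - rate \<bar>y\<bar>)))"
        by (simp add: rate_abs algebra_simps flip: exp_add)
      also have "\<dots> \<le> exp (real N * (ln 2 + H \<beta> p \<bar>y\<bar>))"
      proof -
        \<comment> \<open>For odd p a negative mean only lowers the weight, so \<open>H\<close> on
          \<open>{0..1}\<close> controls both signs.\<close>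
        have "y ^ p \<le> \<bar>y\<bar> ^ p"
          by (metis abs_ge_self power_abs)
        then show ?thesis
          unfolding H_eq_rate exp_le_cancel_iff using assms(1)
          by (intro mult_left_mono add_left_mono diff_right_mono) auto
      qed
      also have "\<dots> \<le> exp (real N * (ln 2 + M))"
        using M[of "\<bar>y\<bar>"] y False by (simp add: mult_left_mono)
      finally show ?thesis .
    qed (simp add: y_def)
  qed
  also have "\<dots> = (real N + 1) * exp (real N * (ln 2 + M))"
    by simp
  finally show ?thesis .
qed

text \<open>The Gibbs variational principle, tested on the product measure with mean \<open>m\<close>:
  \<open>Q = Bernstein N _ ((1 + m) / 2)\<close> is its law of the number of positive spins.\<close>

lemma partition_function_ge:
  assumes "\<beta> > 0" "N \<ge> 1" "0 < m" "m < 1" "\<epsilon> > 0"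
  shows "exp (real N * (ln 2 + H \<beta> p m - \<beta> * real p * (\<epsilon> / 2 + 1 / (2 * \<epsilon> * real N))))
      \<le> partition_function \<beta> p N"
proof -
  define \<theta> where "\<theta> = (1 + m) / 2"
  have \<theta>: "0 < \<theta>" "\<theta> < 1" "1 - \<theta> = (1 - m) / 2" "m = 2 * \<theta> - 1"
    using assms by (auto simp: \<theta>_def field_simps)
  define Q where "Q k = Bernstein N k \<theta>" for k
  have Q0: "Q k \<ge> 0" for k
    using \<theta> by (simp add: Q_def Bernstein_nonneg)
  have Q1: "(\<Sum>k\<le>N. Q k) = 1" and Qk: "(\<Sum>k\<le>N. real k * Q k) = real N * \<theta>"
    and Qkk: "(\<Sum>k\<le>N. real k * (real k - 1) * Q k) = real N * (real N - 1) * \<theta>\<^sup>2"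
    by (simp_all add: Q_def)
  define x where "x k = (2 * real k - real N) / real N" for k
  \<comment> \<open>\<open>exp (f k)\<close> is the Gibbs weight of a configuration with k positive
    spins divided by its probability under the product measure, so the partition function is the
    \<open>Q\<close>-mean of \<open>exp (f k)\<close>.\<close>
  define f where "f k = \<beta> * real N * x k ^ p - real k * ln \<theta> - (real N - real k) * ln (1 - \<theta>)" for k
  define e where "e = \<epsilon> / 2 + 1 / (2 * \<epsilon> * real N)"
  define c where "c = real N * (ln 2 + H \<beta> p m - \<beta> * real p * e)"
  have Z: "partition_function \<beta> p N = (\<Sum>k\<le>N. Q k * exp (f k))"
  proof -
    have "partition_function \<beta> p N = (\<Sum>k\<le>N. real (N choose k) * exp (\<beta> * real N * x k ^ p))"
      unfolding partition_function_def gibbs_weight_def x_def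
      by (rule sum_configs[where g = "\<lambda>y. exp (\<beta> * real N * y ^ p)"])
    also have "\<dots> = (\<Sum>k\<le>N. Q k * exp (f k))"
    proof (rule sum.cong[OF refl])
      fix k
      assume "k \<in> {..N}"
      then have "exp (- (real N - real k) * ln (1 - \<theta>)) * (1 - \<theta>) ^ (N - k) = 1"
        using \<theta>(1,2) exp_of_nat_mult[of "N - k" "ln (1 - \<theta>)"]
        by (simp add: of_nat_diff exp_minus flip: minus_mult_left del: minus_diff_eq)
      moreover have "exp (- real k * ln \<theta>) * \<theta> ^ k = 1"
        using \<theta>(1,2) exp_of_nat_mult[of k "ln \<theta>"] by (simp add: exp_minus)
      moreover have "exp (f k) = exp (\<beta> * real N * x k ^ p) * exp (- real k * ln \<theta>)
          * exp (- (real N - real k) * ln (1 - \<theta>))"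
        unfolding f_def exp_add[symmetric] by (simp add: algebra_simps)
      moreover have "Q k = real (N choose k) * \<theta> ^ k * (1 - \<theta>) ^ (N - k)"
        by (simp add: Q_def Bernstein_def)
      ultimately show "real (N choose k) * exp (\<beta> * real N * x k ^ p) = Q k * exp (f k)"
        by (simp add: mult_ac)
    qed
    finally show ?thesis .
  qed
  \<comment> \<open>The left side is the variance of the mean under \<open>Q\<close>, equal to
    \<open>(1 - m\<^sup>2) / real N\<close>; the square is expanded through k(k-1) to use the
    factorial moment \<open>Qkk\<close>.\<close>
  have var: "(\<Sum>k\<le>N. Q k * (x k - m)\<^sup>2) \<le> 1 / real N"
  proof -
    have "Q k * (x k - m)\<^sup>2 = 4 / (real N)\<^sup>2 * (real k * (real k - 1) * Q k
        + (1 - 2 * real N * \<theta>) * (real k * Q k) + (real N)\<^sup>2 * \<theta>\<^sup>2 * Q k)" for k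
    proof -
      have "x k - m = 2 / real N * (real k - real N * \<theta>)"
        using assms by (simp add: x_def \<theta>(4) field_simps)
      then have "(x k - m)\<^sup>2 = 4 / (real N)\<^sup>2 * (real k - real N * \<theta>)\<^sup>2"
        by (simp only: power_mult_distrib power_divide) simp
      moreover have "(real k - real N * \<theta>)\<^sup>2
          = real k * (real k - 1) + (1 - 2 * real N * \<theta>) * real k + (real N)\<^sup>2 * \<theta>\<^sup>2"
        by (simp add: power2_eq_square algebra_simps)
      ultimately show ?thesis
        by (simp only: distrib_left distrib_right mult_ac)
    qed
    then have "(\<Sum>k\<le>N. Q k * (x k - m)\<^sup>2) = 4 / (real N)\<^sup>2 * ((\<Sum>k\<le>N. real k * (real k - 1) * Q k)
        + (1 - 2 * real N * \<theta>) * (\<Sum>k\<le>N. real k * Q k) + (real N)\<^sup>2 * \<theta>\<^sup>2 * (\<Sum>k\<le>N. Q k))"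
      by (simp only: sum.distrib sum_distrib_left[symmetric])
    also have "\<dots> = 4 * \<theta> * (1 - \<theta>) / real N"
      unfolding Q1 Qk Qkk using assms by (simp add: field_simps power2_eq_square)
    also have "4 * \<theta> * (1 - \<theta>) = 1 - m\<^sup>2"
      by (simp add: \<theta>(4) power2_eq_square algebra_simps)
    also have "(1 - m\<^sup>2) / real N \<le> 1 / real N"
      by (intro divide_right_mono) auto
    finally show ?thesis .
  qed
  \<comment> \<open>On [-1, 1] the power is Lipschitz with constant p, and |d| <=
    \<open>\<epsilon> / 2\<close> + \<open>d\<^sup>2 / (2 * \<epsilon>)\<close> trades the absolute
    deviation d for the variance; this produces \<open>e\<close>.\<close>
  have moment: "(\<Sum>k\<le>N. Q k * x k ^ p) \<ge> m ^ p - real p * e"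
  proof -
    have "Q k * x k ^ p \<ge> (m ^ p - real p * (\<epsilon> / 2)) * Q k - real p / (2 * \<epsilon>) * (Q k * (x k - m)\<^sup>2)"
      if "k \<in> {..N}" for k
    proof -
      have "\<bar>x k\<bar> \<le> 1"
        using assms that by (auto simp: x_def abs_le_iff field_simps)
      then have "\<bar>x k ^ p - m ^ p\<bar> \<le> real p * \<bar>x k - m\<bar>"
        using norm_power_diff[of "x k" m p] assms by simp
      also have "\<bar>x k - m\<bar> \<le> \<epsilon> / 2 + (x k - m)\<^sup>2 / (2 * \<epsilon>)"
      proof -
        have "0 \<le> (\<bar>x k - m\<bar> - \<epsilon>)\<^sup>2"
          by simp
        then have "2 * \<epsilon> * \<bar>x k - m\<bar> \<le> \<epsilon>\<^sup>2 + (x k - m)\<^sup>2"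
          by (simp add: power2_diff[of "\<bar>x k - m\<bar>"] mult_ac)
        then show ?thesis
          using assms by (simp add: field_simps power2_eq_square)
      qed
      finally have "x k ^ p \<ge> m ^ p - real p * (\<epsilon> / 2 + (x k - m)\<^sup>2 / (2 * \<epsilon>))"
        by (simp add: mult_left_mono)
      then have "Q k * (m ^ p - real p * (\<epsilon> / 2 + (x k - m)\<^sup>2 / (2 * \<epsilon>))) \<le> Q k * x k ^ p"
        by (rule mult_left_mono[OF _ Q0])
      then show ?thesis
        by (simp add: algebra_simps)
    qed
    then have "(\<Sum>k\<le>N. (m ^ p - real p * (\<epsilon> / 2)) * Q k - real p / (2 * \<epsilon>) * (Q k * (x k - m)\<^sup>2))
        \<le> (\<Sum>k\<le>N. Q k * x k ^ p)"
      by (rule sum_mono)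
    then have "(m ^ p - real p * (\<epsilon> / 2)) - real p / (2 * \<epsilon>) * (\<Sum>k\<le>N. Q k * (x k - m)\<^sup>2)
        \<le> (\<Sum>k\<le>N. Q k * x k ^ p)"
      by (simp only: sum_subtractf sum_distrib_left[symmetric] Q1 mult_1_right)
    moreover have "real p / (2 * \<epsilon>) * (\<Sum>k\<le>N. Q k * (x k - m)\<^sup>2) \<le> real p / (2 * \<epsilon>) * (1 / real N)"
      using assms by (intro mult_left_mono var) auto
    ultimately show ?thesis
      by (simp add: e_def algebra_simps)
  qed
  have "Q k * f k = \<beta> * real N * (Q k * x k ^ p) - (ln \<theta> - ln (1 - \<theta>)) * (real k * Q k)
      - real N * ln (1 - \<theta>) * Q k" for k
    by (simp add: f_def algebra_simps)
  then have "(\<Sum>k\<le>N. Q k * f k) = \<beta> * real N * (\<Sum>k\<le>N. Q k * x k ^ p)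
      - real N * (\<theta> * ln \<theta> + (1 - \<theta>) * ln (1 - \<theta>))"
    by (simp only: sum_subtractf sum_distrib_left[symmetric] Q1 Qk) (simp add: algebra_simps)
  also have "\<theta> * ln \<theta> + (1 - \<theta>) * ln (1 - \<theta>) = rate m - ln 2"
    using rate_entropy[of m] assms unfolding \<theta>(3) by (simp add: \<theta>_def)
  also have "\<beta> * real N * (\<Sum>k\<le>N. Q k * x k ^ p) - real N * (rate m - ln 2)
      \<ge> \<beta> * real N * (m ^ p - real p * e) - real N * (rate m - ln 2)"
    using assms by (intro diff_right_mono mult_left_mono moment) auto
  also have "\<beta> * real N * (m ^ p - real p * e) - real N * (rate m - ln 2) = c"
    by (simp add: c_def H_eq_rate algebra_simps)
  finally have mean_f: "c \<le> (\<Sum>k\<le>N. Q k * f k)" .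
  \<comment> \<open>Jensen's inequality through the tangent of \<open>exp\<close> at
    \<open>c\<close>: the bracket is 1 plus the excess of the mean of \<open>f\<close> over
    \<open>c\<close>.\<close>
  have "exp c * 1 \<le> exp c * ((1 - c) * (\<Sum>k\<le>N. Q k) + (\<Sum>k\<le>N. Q k * f k))"
    using mean_f by (intro mult_left_mono) (auto simp: Q1)
  also have "\<dots> = (\<Sum>k\<le>N. Q k * (exp c * (1 + (f k - c))))"
    unfolding sum_distrib_left sum.distrib[symmetric] by (intro sum.cong) (auto simp: algebra_simps)
  also have "\<dots> \<le> (\<Sum>k\<le>N. Q k * (exp c * exp (f k - c)))"
    by (intro sum_mono mult_left_mono exp_ge_add_one_self Q0) auto
  also have "\<dots> = partition_function \<beta> p N"
    by (simp add: Z flip: exp_add)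
  finally show ?thesis
    by (simp add: c_def e_def)
qed

section \<open>Exponential bound for deviations of the mean\<close>

lemma measure_curie_weiss:
  assumes "A \<subseteq> configs N"
  shows "measure (curie_weiss \<beta> p N) A = (\<Sum>x\<in>A. gibbs_weight \<beta> p N x) / partition_function \<beta> p N"
proof -
  have "0 \<le> gibbs_weight \<beta> p N x / partition_function \<beta> p N" for x
    using partition_function_pos[of \<beta> p N] by (simp add: gibbs_weight_def)
  then show ?thesis
    using assms unfolding curie_weiss_def
    by (subst measure_point_measure_finite_if) (auto simp: finite_configs sum_divide_distrib)
qed

lemma mean_concentration:
  assumes "\<beta> > 0" "p > 0" "beta_star p < \<beta>" "open U" "m_star \<beta> p \<in> U"
  shows "\<exists>C>0. \<forall>\<^sub>F N in sequentially.
    measure (curie_weiss \<beta> p N) {x \<in> configs N. \<bar>mean N x\<bar> \<notin> U} \<le> exp (- C * real N)"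
proof -
  define m where "m = m_star \<beta> p"
  note ms = m_star_unique_max[OF assms(1-3), folded m_def]
  obtain \<eta> where \<eta>: "\<eta> > 0" "\<And>y. y \<in> {0..1} - U \<Longrightarrow> H \<beta> p y \<le> H \<beta> p m - \<eta>"
    using H_gap[of U m \<beta> p] assms ms by (auto simp: m_def)
  \<comment> \<open>This choice makes the first error term of \<open>partition_function_ge\<close>
    equal to \<open>\<eta> / 4\<close>. The 1/N term and the factor N + 1 eventually cost at most
    \<open>\<eta> / 4\<close> each, so a rate of \<open>\<eta> / 4\<close> is left from the gap
    \<open>\<eta>\<close>.\<close>
  define \<epsilon> where "\<epsilon> = \<eta> / (2 * \<beta> * real p)"
  have \<epsilon>: "\<epsilon> > 0"
    using assms \<eta> by (simp add: \<epsilon>_def)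
  have "(\<lambda>N. \<beta> * real p * (1 / (2 * \<epsilon> * real N))) \<longlonglongrightarrow> 0"
    using \<epsilon> by real_asymp
  then have ev1: "\<forall>\<^sub>F N in sequentially. \<beta> * real p * (1 / (2 * \<epsilon> * real N)) < \<eta> / 4"
    using \<eta> by (intro order_tendstoD) auto
  have ev2: "\<forall>\<^sub>F N in sequentially. real N + 1 \<le> exp (\<eta> / 4 * real N)"
    using \<eta>(1) by real_asymp
  have "\<forall>\<^sub>F N in sequentially.
    measure (curie_weiss \<beta> p N) {x \<in> configs N. \<bar>mean N x\<bar> \<notin> U} \<le> exp (- (\<eta> / 4) * real N)"
    using ev1 ev2 eventually_ge_at_top[of 1]
  proof eventually_elim
    case (elim N)
    let ?Z = "partition_function \<beta> p N"
    have "\<beta> * real p * (\<epsilon> / 2) = \<eta> / 4"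
      using assms by (simp add: \<epsilon>_def)
    then have "\<beta> * real p * (\<epsilon> / 2 + 1 / (2 * \<epsilon> * real N)) \<le> \<eta> / 2"
      using elim(1) unfolding distrib_left by linarith
    then have "exp (real N * (ln 2 + H \<beta> p m - \<eta> / 2))
        \<le> exp (real N * (ln 2 + H \<beta> p m - \<beta> * real p * (\<epsilon> / 2 + 1 / (2 * \<epsilon> * real N))))"
      by (simp add: mult_left_mono)
    also have "\<dots> \<le> ?Z"
      using ms by (intro partition_function_ge assms elim \<epsilon>) auto
    finally have Z: "exp (real N * (ln 2 + H \<beta> p m - \<eta> / 2)) \<le> ?Z" .
    have "measure (curie_weiss \<beta> p N) {x \<in> configs N. \<bar>mean N x\<bar> \<notin> U}
        = (\<Sum>x | x \<in> configs N \<and> \<bar>mean N x\<bar> \<notin> U. gibbs_weight \<beta> p N x) / ?Z"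
      by (rule measure_curie_weiss) auto
    also have "\<dots> \<le> (real N + 1) * exp (real N * (ln 2 + (H \<beta> p m - \<eta>)))
        / exp (real N * (ln 2 + H \<beta> p m - \<eta> / 2))"
      by (intro frac_le gibbs_weight_sum_le assms elim \<eta> Z) auto
    also have "\<dots> = (real N + 1) * exp (- (\<eta> / 2) * real N)"
      unfolding times_divide_eq_right[symmetric] exp_diff[symmetric] by (simp add: algebra_simps)
    also have "\<dots> \<le> exp (\<eta> / 4 * real N) * exp (- (\<eta> / 2) * real N)"
      by (intro mult_right_mono elim) auto
    also have "\<dots> = exp (- (\<eta> / 4) * real N)"
      by (simp flip: exp_add)
    finally show ?case .
  qed
  with \<eta> show ?thesis
    by (intro exI[of _ "\<eta> / 4"]) auto
qed

section \<open>Identification near the maximizer\<close>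

lemma log_inverse_ge_iff:
  assumes "0 < y" "y < 1" "b > 0"
  shows "real n \<le> log (inverse y) b \<longleftrightarrow> 1 \<le> b * y ^ n"
proof -
  have "real n \<le> log (inverse y) b \<longleftrightarrow> inverse y powr real n \<le> b"
    using assms by (intro le_log_iff) (auto simp: one_less_inverse_iff)
  also have "inverse y powr real n = inverse (y ^ n)"
    using assms by (simp add: powr_realpow power_inverse)
  also have "inverse (y ^ n) \<le> b \<longleftrightarrow> 1 \<le> b * y ^ n"
    using assms by (simp add: field_simps)
  finally show ?thesis .
qed

text \<open>Trades the logarithmic cutoff for a power inequality, to which continuity in y applies
  directly.\<close>

lemma candidates_iff:
  assumes "\<beta> > 0" "\<delta> > 0" "0 < \<bar>y\<bar>" "\<bar>y\<bar> < 1"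
  shows "q \<in> candidates \<beta> \<delta> y \<longleftrightarrow> q \<in> L \<beta> \<and> 1 \<le> (2 * \<beta> + \<delta>) * \<bar>y\<bar> ^ (q - 2)"
proof (cases "2 \<le> q")
  case True
  then have "real q \<le> log (inverse \<bar>y\<bar>) (2 * \<beta> + \<delta>) + 2 \<longleftrightarrow> 1 \<le> (2 * \<beta> + \<delta>) * \<bar>y\<bar> ^ (q - 2)"
    using assms log_inverse_ge_iff[of "\<bar>y\<bar>" "2 * \<beta> + \<delta>" "q - 2"] by (simp add: diff_le_eq)
  with True assms show ?thesis
    by (auto simp: candidates_def L_def)
qed (simp add: candidates_def L_def)

text \<open>Each requirement is open at \<open>y = m\<close>. Only finitely many such conditions can
  be intersected, so the competitors are first bounded uniformly in y.\<close>

lemma eventually_identifies: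
  assumes "\<beta> > 0" "\<delta> > 0" "p \<in> L2 \<beta>"
  defines "m \<equiv> m_star \<beta> p"
  shows "\<forall>\<^sub>F y in nhds m. 0 < y \<and> y < 1 \<and> 1 \<le> (2 * \<beta> + \<delta>) * y ^ (p - 2) \<and>
    (\<forall>q\<in>L \<beta>. q \<noteq> p \<longrightarrow> 1 \<le> (2 * \<beta> + \<delta>) * y ^ (q - 2) \<longrightarrow> \<bar>m\<^sup>2 - y\<^sup>2\<bar> < \<bar>(m_star \<beta> q)\<^sup>2 - y\<^sup>2\<bar>)"
proof -
  have pL: "p \<in> L \<beta>" and sep: "\<And>q. q \<in> L \<beta> \<Longrightarrow> q \<noteq> p \<Longrightarrow> m_star \<beta> q \<noteq> m"
    using assms by (auto simp: L2_def L1_def)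
  have pos: "0 < m_star \<beta> q" if "q \<in> L \<beta>" for q
    using m_star_unique_max(1)[of \<beta> q] that assms by (auto simp: L_def)
  have m: "0 < m" "m < 1"
    using m_star_unique_max(1,2)[of \<beta> p] pL assms by (auto simp: L_def m_def)
  have id: "((\<lambda>y. y) \<longlongrightarrow> m) (nhds m)"
    by (simp add: filterlim_ident)
  \<comment> \<open>Keeping y below a fixed \<open>r < 1\<close> lets a single \<open>K\<close>
    bound the competitors for all such y.\<close>
  obtain r where r: "m < r" "r < 1"
    using m(2) dense by blast
  have "2 * \<beta> * m ^ (p - 2) \<ge> 1"
    using m_star_power_ge[of \<beta> p] pL assms by (auto simp: L_def)
  \<comment> \<open>The slack \<open>\<delta>\<close> makes the inequality strict at
    \<open>m\<close>, hence stable nearby.\<close>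
  moreover have "\<delta> * m ^ (p - 2) > 0"
    using assms m by simp
  ultimately have "1 < (2 * \<beta> + \<delta>) * m ^ (p - 2)"
    by (simp add: algebra_simps)
  moreover have "((\<lambda>y. (2 * \<beta> + \<delta>) * y ^ (p - 2)) \<longlongrightarrow> (2 * \<beta> + \<delta>) * m ^ (p - 2)) (nhds m)"
    by (intro tendsto_intros id)
  ultimately have e1: "\<forall>\<^sub>F y in nhds m. 1 < (2 * \<beta> + \<delta>) * y ^ (p - 2)"
    by (intro order_tendstoD)
  have "(\<lambda>n. (2 * \<beta> + \<delta>) * r ^ (n - 2)) \<longlonglongrightarrow> 0"
  proof -
    have "(\<lambda>n. r ^ n) \<longlonglongrightarrow> 0"
      using m r by (intro LIMSEQ_realpow_zero) auto
    then have "(\<lambda>n. (2 * \<beta> + \<delta>) * r ^ (n - 2)) \<longlonglongrightarrow> (2 * \<beta> + \<delta>) * 0"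
      by (intro tendsto_mult tendsto_const)
        (rule filterlim_compose[OF _ filterlim_minus_const_nat_at_top])
    then show ?thesis
      by simp
  qed
  then have "\<forall>\<^sub>F n in sequentially. (2 * \<beta> + \<delta>) * r ^ (n - 2) < 1"
    by (intro order_tendstoD) auto
  then obtain K where K: "\<And>n. n \<ge> K \<Longrightarrow> (2 * \<beta> + \<delta>) * r ^ (n - 2) < 1"
    by (auto simp: eventually_sequentially)
  have "\<forall>\<^sub>F y in nhds m. \<bar>m\<^sup>2 - y\<^sup>2\<bar> < \<bar>(m_star \<beta> q)\<^sup>2 - y\<^sup>2\<bar>" if "q \<in> L \<beta>" "q \<noteq> p" for q
  proof -
    \<comment> \<open>Both maximizers are positive, so different values have different
      squares.\<close>
    have "(m_star \<beta> q)\<^sup>2 \<noteq> m\<^sup>2"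
      using sep[OF that] pos[OF that(1)] m by (simp add: power2_eq_iff)
    then have "0 < \<bar>(m_star \<beta> q)\<^sup>2 - m\<^sup>2\<bar> - \<bar>m\<^sup>2 - m\<^sup>2\<bar>"
      by simp
    moreover have "((\<lambda>y. \<bar>(m_star \<beta> q)\<^sup>2 - y\<^sup>2\<bar> - \<bar>m\<^sup>2 - y\<^sup>2\<bar>) \<longlongrightarrow>
        \<bar>(m_star \<beta> q)\<^sup>2 - m\<^sup>2\<bar> - \<bar>m\<^sup>2 - m\<^sup>2\<bar>) (nhds m)"
      by (intro tendsto_intros id)
    ultimately have "\<forall>\<^sub>F y in nhds m. 0 < \<bar>(m_star \<beta> q)\<^sup>2 - y\<^sup>2\<bar> - \<bar>m\<^sup>2 - y\<^sup>2\<bar>"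
      by (intro order_tendstoD)
    then show ?thesis
      by eventually_elim simp
  qed
  then have e2: "\<forall>\<^sub>F y in nhds m. \<forall>q\<in>{q \<in> L \<beta>. q < K \<and> q \<noteq> p}.
      \<bar>m\<^sup>2 - y\<^sup>2\<bar> < \<bar>(m_star \<beta> q)\<^sup>2 - y\<^sup>2\<bar>"
    by (intro eventually_ball_finite) auto
  have e3: "\<forall>\<^sub>F y in nhds m. 0 < y" and e4: "\<forall>\<^sub>F y in nhds m. y < r"
    using m r by (auto intro!: order_tendstoD[OF id])
  show ?thesis
    using e1 e2 e3 e4
  proof eventually_elim
    case (elim y)
    have "q < K" if "1 \<le> (2 * \<beta> + \<delta>) * y ^ (q - 2)" for q
    proof (rule ccontr)
      assume "\<not> q < K"
      moreover have "(2 * \<beta> + \<delta>) * y ^ (q - 2) \<le> (2 * \<beta> + \<delta>) * r ^ (q - 2)"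
        using assms elim by (intro mult_left_mono power_mono) auto
      ultimately show False
        using K[of q] that by auto
    qed
    then show ?case
      using elim r by auto
  qed
qed

theorem theorem4:
  fixes \<beta> \<delta> :: real and p :: nat
  assumes "\<beta> > 0" and "\<delta> > 0" and "p \<in> L2 \<beta>"
  shows "\<exists>C>0. \<forall>phat. is_estimator \<beta> \<delta> phat \<longrightarrow>
           (\<forall>\<^sub>F N in sequentially.
              measure (curie_weiss \<beta> p N) {x \<in> space (curie_weiss \<beta> p N). phat N x = p}
                \<ge> 1 - exp (- C * real N))"
proof -
  have pL: "p \<in> L \<beta>"
    using assms by (simp add: L2_def)
  obtain U where U: "open U" "m_star \<beta> p \<in> U"
    "\<And>y. y \<in> U \<Longrightarrow> 0 < y \<and> y < 1 \<and> 1 \<le> (2 * \<beta> + \<delta>) * y ^ (p - 2)"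
    "\<And>y q. y \<in> U \<Longrightarrow> q \<in> L \<beta> \<Longrightarrow> q \<noteq> p \<Longrightarrow> 1 \<le> (2 * \<beta> + \<delta>) * y ^ (q - 2) \<Longrightarrow>
      \<bar>(m_star \<beta> p)\<^sup>2 - y\<^sup>2\<bar> < \<bar>(m_star \<beta> q)\<^sup>2 - y\<^sup>2\<bar>"
    using eventually_identifies[OF assms] unfolding eventually_nhds by blast
  obtain C where C: "C > 0" and conc: "\<forall>\<^sub>F N in sequentially.
      measure (curie_weiss \<beta> p N) {x \<in> configs N. \<bar>mean N x\<bar> \<notin> U} \<le> exp (- C * real N)"
    using mean_concentration[OF assms(1) _ _ U(1,2)] pL by (auto simp: L_def)
  show ?thesis
  \<comment> \<open>\<open>C\<close> was obtained before \<open>phat\<close> is fixed, so one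
    constant serves every way of breaking ties.\<close>
  proof (intro exI[of _ C] conjI allI impI C)
    fix phat
    assume est: "is_estimator \<beta> \<delta> phat"
    show "\<forall>\<^sub>F N in sequentially.
        measure (curie_weiss \<beta> p N) {x \<in> space (curie_weiss \<beta> p N). phat N x = p}
          \<ge> 1 - exp (- C * real N)"
      using conc eventually_ge_at_top[of 1]
    proof eventually_elim
      case (elim N)
      interpret prob_space "curie_weiss \<beta> p N"
        by (rule prob_space_curie_weiss)
      have hit: "phat N x = p" if x: "x \<in> configs N" and y: "\<bar>mean N x\<bar> \<in> U" for x
      proof (rule ccontr)
        assume ne: "phat N x \<noteq> p"
        let ?y = "mean N x"
        have range: "0 < \<bar>?y\<bar>" "\<bar>?y\<bar> < 1"
          using U(3)[OF y] by auto
        note cand = candidates_iff[OF assms(1,2) range]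
        \<comment> \<open>With \<open>p\<close> a candidate, the candidate set is nonempty and
          \<open>is_estimator\<close> does constrain \<open>phat\<close> on this sample.\<close>
        have p: "p \<in> candidates \<beta> \<delta> ?y"
          using cand U(3)[OF y] pL by blast
        moreover have "\<bar>?y\<bar> \<noteq> 1"
          using range by simp
        ultimately have "is_arg_min (\<lambda>q. \<bar>(m_star \<beta> q)\<^sup>2 - ?y\<^sup>2\<bar>)
            (\<lambda>q. q \<in> candidates \<beta> \<delta> ?y) (phat N x)"
          using est elim(2) x unfolding is_estimator_def by blast
        then have "phat N x \<in> candidates \<beta> \<delta> ?y"
          "\<not> \<bar>(m_star \<beta> p)\<^sup>2 - ?y\<^sup>2\<bar> < \<bar>(m_star \<beta> (phat N x))\<^sup>2 - ?y\<^sup>2\<bar>"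
          using p by (auto simp: is_arg_min_def)
        then show False
          using cand U(4)[OF y _ ne] by auto
      qed
      have "1 - exp (- C * real N) \<le> 1 - prob {x \<in> configs N. \<bar>mean N x\<bar> \<notin> U}"
        using elim(1) by simp
      also have "\<dots> = prob (space (curie_weiss \<beta> p N) - {x \<in> configs N. \<bar>mean N x\<bar> \<notin> U})"
        by (rule prob_compl[symmetric]) (auto simp: sets_curie_weiss)
      also have "\<dots> \<le> prob {x \<in> space (curie_weiss \<beta> p N). phat N x = p}"
        using hit by (intro finite_measure_mono) (auto simp: space_curie_weiss sets_curie_weiss)
      finally show ?case .
    qed
  qed
qed

end
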